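(* Let $d\in\mathbb{N}$, let $S\in\mathbb{R}^{d\times d}$ be an invertible matrix and let $V$ be a random vector uniformly distributed in $[0,1]^d$. For any $f\in L^1(\mathbb{R}^d)$, the method $Q_S^V$ satisfies \[ \mathbb{E}\left(Q_S^V(f)\right)=I_d(f). \] In particular, if $B\in\mathbb{R}^{d\times d}$ is a Frolov matrix, $n\in\mathbb{N}$, $U$ is uniformly distributed in $[1,2^{1/d}]^d$, and $U$ and $V$ are independent, then the method $Q_{n^{1/d}\hat{U}B}^V$ is well-defined and unbiased on $L^1(\mathbb{R}^d)$, that is, for every $f\in L^1(\mathbb{R}^d)$ the series defining $Q_{n^{1/d}\hat{U}B}^V(f)$ converges absolutely almost surely and $\mathbb{E}\left(Q_{n^{1/d}\hat{U}B}^V(f)\right)=I_d(f)$.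
   Context: Notation: $\mathbb{N}=\{1,2,\dots\}$ and $I_d(f)=\int_{\mathbb{R}^d} f(x)\,dx$; functions are real-valued. For an invertible matrix $S\in\mathbb{R}^{d\times d}$ and $v\in\mathbb{R}^d$, the quadrature rule $Q_S^v$ is \[Q_S^v(f)=\frac{1}{|\det S|}\sum_{m\in\mathbb{Z}^d} f\left(S^{-\top}(m+v)\right),\] where $S^{-\top}$ is the transpose of the inverse of $S$; $Q_S^V$ is this rule with the random shift $V$. For $u\in\mathbb{R}^d$, $\hat{u}=\mathrm{diag}(u_1,\dots,u_d)$. A matrix $B\in\mathbb{R}^{d\times d}$ is a Frolov matrix if: (a) $B$ is invertible; (b) $\left|\prod_{j=1}^d (Bm)_j\right|\geq 1$ for every $m\in\mathbb{Z}^d\setminus\{0\}$; (c) for all $x,y\in\mathbb{R}^d$ the box $[x,y]=\{z\in\mathbb{R}^d : z_j \text{ lies between } x_j \text{ and } y_j \text{ (inclusive) for } j=1,\dots,d\}$ with volume $V_0=\prod_{j=1}^d|x_j-y_j|$ contains at most $V_0+1$ lattice points $Bm$, $m\in\mathbb{Z}^d$. *)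

theory Defs
  imports "HOL-Probability.Probability"
begin

definition int_vec :: "int ^ 'n \<Rightarrow> real ^ 'n" where
  "int_vec m = (\<chi> i. of_int (m $ i))"

definition diag_matrix :: "real ^ 'n \<Rightarrow> real ^ 'n ^ 'n" where
  "diag_matrix u = (\<chi> i j. if i = j then u $ i else 0)"

definition node :: "real ^ 'n ^ 'n \<Rightarrow> real ^ 'n \<Rightarrow> int ^ 'n \<Rightarrow> real ^ 'n::finite" where
  "node S v m = transpose (matrix_inv S) *v (int_vec m + v)"

text \<open>
  The lattice sum is an unordered infinite sum. It takes the value 0 if the family is not summable,
  and \<open>matrix_inv S\<close> is unspecified for singular \<open>S\<close>, so \<open>quad_rule S v f\<close> is only meaningful
  under \<open>quad_rule_defined S v f\<close>.
\<close>
definition quad_rule :: "real ^ 'n ^ 'n \<Rightarrow> real ^ 'n \<Rightarrow> (real ^ 'n \<Rightarrow> real) \<Rightarrow> real" where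
  "quad_rule S v f = 1 / \<bar>det S\<bar> * (\<Sum>\<^sub>\<infinity>m\<in>UNIV. f (node S v m))"

definition quad_rule_defined :: "real ^ 'n ^ 'n \<Rightarrow> real ^ 'n \<Rightarrow> (real ^ 'n \<Rightarrow> real) \<Rightarrow> bool" where
  "quad_rule_defined S v f \<longleftrightarrow> invertible S \<and> (\<lambda>m. \<bar>f (node S v m)\<bar>) summable_on UNIV"

text \<open>The corners of the box are in no particular order.\<close>
definition box_between :: "real ^ 'n \<Rightarrow> real ^ 'n \<Rightarrow> (real ^ 'n) set" where
  "box_between x y = {z. \<forall>j. min (x $ j) (y $ j) \<le> z $ j \<and> z $ j \<le> max (x $ j) (y $ j)}"

text \<open>Finiteness is required explicitly because \<open>card\<close> of an infinite set is 0.\<close>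
definition frolov_matrix :: "real ^ 'n ^ 'n \<Rightarrow> bool" where
  "frolov_matrix B \<longleftrightarrow>
     invertible B \<and>
     (\<forall>m::int ^ 'n. m \<noteq> 0 \<longrightarrow> \<bar>\<Prod>j\<in>UNIV. (B *v int_vec m) $ j\<bar> \<ge> 1) \<and>
     (\<forall>x y. let P = {B *v int_vec m |m. B *v int_vec m \<in> box_between x y} in
        finite P \<and> real (card P) \<le> (\<Prod>j\<in>UNIV. \<bar>x $ j - y $ j\<bar>) + 1)"

definition uniformly_distributed :: "'w measure \<Rightarrow> ('w \<Rightarrow> real ^ 'n) \<Rightarrow> (real ^ 'n) set \<Rightarrow> bool" where
  "uniformly_distributed M X A \<longleftrightarrow>
     distributed M lborel X (\<lambda>x. ennreal (indicator A x / measure lborel A))"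

text \<open>
  Functions in \<open>L\<^sup>1\<close> are only Lebesgue measurable, so their composition with a Borel random vector
  is in general measurable only for the completion of \<open>M\<close>. Expectations are therefore taken with
  respect to \<open>completion M\<close>; for \<open>M\<close>-measurable random variables this is the expectation in \<open>M\<close>
  (fact \<open>integral_completion\<close>).
\<close>
definition has_expectation :: "'w measure \<Rightarrow> ('w \<Rightarrow> real) \<Rightarrow> real \<Rightarrow> bool" where
  "has_expectation M X a \<longleftrightarrow>
     integrable (completion M) X \<and> integral\<^sup>L (completion M) X = a"

end

theory Submission
  imports Defs
begin

text \<open>
  The lattice translates of the unit cube tile the space. So for a fixed invertible matrix \<open>A\<close> (the
  transposed inverse of \<open>S\<close>) and a nonnegative Borel function \<open>h\<close>, the substitution \<open>x = A (m + v)\<close>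
  shows that \<open>\<bar>det A\<bar> \<Sum>\<^sub>m h (A (m + v))\<close>, integrated over the shift \<open>v\<close>, equals \<open>\<integral> h\<close>. Since this
  value does not depend on \<open>A\<close>, the same holds when \<open>A\<close> is random and independent of the shift.
  Let \<open>g\<close> be a Borel version of \<open>f\<close>. The choice \<open>h = \<bar>g\<bar>\<close> yields almost sure absolute convergence, the
  positive and negative parts of \<open>g\<close> yield the expectation, and the indicator of a Borel null set
  containing all points where \<open>f\<close> and \<open>g\<close> differ shows that almost surely no node meets that set.
\<close>

section \<open>Linear change of variables for Lebesgue measure\<close>

text \<open>By Tonelli the coordinate along \<open>b\<close> can be integrated first, with all
  others held fixed. The shear then moves it by the constant \<open>x \<bullet> a\<close>, and
  one-dimensional Lebesgue measure is translation invariant.\<close>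

lemma nn_integral_lborel_shear:
  fixes k :: "'a::euclidean_space \<Rightarrow> ennreal"
  assumes [measurable]: "k \<in> borel_measurable borel" and ab: "a \<in> Basis" "b \<in> Basis" "a \<noteq> b"
  shows "(\<integral>\<^sup>+x. k (x + (x \<bullet> a) *\<^sub>R b) \<partial>lborel) = (\<integral>\<^sup>+x. k x \<partial>lborel)"
proof -
  interpret product_sigma_finite "\<lambda>_::'a. lborel :: real measure" ..
  define I where "I = Basis - {b}"
  \<comment> \<open>\<open>s y\<close> has no component along \<open>b\<close>, so every point is
    \<open>t *\<^sub>R b + s y\<close> for exactly one \<open>t\<close> and one family
    \<open>y\<close> of coordinates over \<open>I\<close>.\<close>
  define s where "s = (\<lambda>y. \<Sum>c\<in>I. y c *\<^sub>R c)"
  have I: "finite I" "b \<notin> I" and Basis: "Basis = insert b I" and "a \<in> I"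
    using ab by (auto simp: I_def)
  have s_a: "s y \<bullet> a = y a" for y
    using \<open>a \<in> I\<close> I(1)
    by (simp add: s_def inner_sum_left inner_Basis I_def ab if_distrib sum.delta' cong: if_cong)
  have split: "(\<integral>\<^sup>+x. h x \<partial>lborel) = (\<integral>\<^sup>+y. \<integral>\<^sup>+t. h (t *\<^sub>R b + s y) \<partial>lborel \<partial>PiM I (\<lambda>_. lborel))"
    if [measurable]: "h \<in> borel_measurable borel" for h :: "'a \<Rightarrow> ennreal"
  proof -
    have "(\<integral>\<^sup>+x. h x \<partial>lborel) =
        (\<integral>\<^sup>+f. h (\<Sum>c\<in>insert b I. f c *\<^sub>R c) \<partial>PiM (insert b I) (\<lambda>_. lborel))"
      by (subst lborel_eq) (simp add: nn_integral_distr Basis)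
    also have "\<dots> = (\<integral>\<^sup>+y. \<integral>\<^sup>+t. h (\<Sum>c\<in>insert b I. (y(b := t)) c *\<^sub>R c) \<partial>lborel \<partial>PiM I (\<lambda>_. lborel))"
      using I by (subst product_nn_integral_insert) auto
    also have "(\<lambda>y t. \<Sum>c\<in>insert b I. (y(b := t)) c *\<^sub>R c) = (\<lambda>y t. t *\<^sub>R b + s y)"
      using I by (auto simp: fun_eq_iff s_def intro!: sum.cong)
    finally show ?thesis by (simp add: fun_eq_iff)
  qed
  have "(\<integral>\<^sup>+t. k (t *\<^sub>R b + s y + (s y \<bullet> a) *\<^sub>R b) \<partial>lborel) = (\<integral>\<^sup>+t. k (t *\<^sub>R b + s y) \<partial>lborel)" for y
    by (subst (2) nn_integral_real_affine[where c=1 and t="s y \<bullet> a"]) (simp_all add: algebra_simps)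
  with ab show ?thesis
    by (simp add: split inner_add_left inner_Basis)
qed

text \<open>
  The substitution rules of \<open>Change_Of_Vars\<close> require a well-ordered index type; this one does not.
\<close>
lemma nn_integral_lborel_matrix:
  fixes A :: "real ^ 'n ^ 'n" and k :: "real ^ 'n \<Rightarrow> ennreal"
  assumes "det A \<noteq> 0" and "k \<in> borel_measurable borel"
  shows "(\<integral>\<^sup>+x. \<bar>det A\<bar> * k (A *v x) \<partial>lborel) = (\<integral>\<^sup>+x. k x \<partial>lborel)"
proof -
  have [measurable]: "(\<lambda>x. A *v x) \<in> borel_measurable borel" for A :: "real ^ 'n ^ 'n"
    by (simp add: borel_measurable_continuous_onI matrix_vector_mult_linear_continuous_on)
  \<comment> \<open>The function \<open>k\<close> is quantified inside the induction predicate
    because in the product case the hypothesis for \<open>B\<close> is applied to \<open>k\<close>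
    composed with \<open>A\<close>.\<close>
  have "det A \<noteq> 0 \<longrightarrow> (\<forall>k :: real ^ 'n \<Rightarrow> ennreal. k \<in> borel_measurable borel \<longrightarrow>
      (\<integral>\<^sup>+x. \<bar>det A\<bar> * k (A *v x) \<partial>lborel) = (\<integral>\<^sup>+x. k x \<partial>lborel))" (is "?P A")
  proof (rule induct_matrix_elementary_alt; intro impI allI)
    fix A B :: "real ^ 'n ^ 'n" and k :: "real ^ 'n \<Rightarrow> ennreal"
    assume A: "?P A" and B: "?P B" and det: "det (A ** B) \<noteq> 0"
      and [measurable]: "k \<in> borel_measurable borel"
    have A: "(\<integral>\<^sup>+x. \<bar>det A\<bar> * k (A *v x) \<partial>lborel) = (\<integral>\<^sup>+x. k x \<partial>lborel)"
      using A det by (simp add: det_mul)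
    have B: "(\<integral>\<^sup>+x. \<bar>det B\<bar> * (\<bar>det A\<bar> * k (A *v (B *v x))) \<partial>lborel) =
        (\<integral>\<^sup>+x. \<bar>det A\<bar> * k (A *v x) \<partial>lborel)"
      using det by (intro B[rule_format, where k = "\<lambda>x. \<bar>det A\<bar> * k (A *v x)"]) (auto simp: det_mul)
    show "(\<integral>\<^sup>+x. \<bar>det (A ** B)\<bar> * k ((A ** B) *v x) \<partial>lborel) = (\<integral>\<^sup>+x. k x \<partial>lborel)"
      unfolding A[symmetric] B[symmetric]
      by (simp add: det_mul abs_mult ennreal_mult' matrix_vector_mul_assoc mult_ac)
  next
    fix A :: "real ^ 'n ^ 'n" and i and k :: "real ^ 'n \<Rightarrow> ennreal"
    assume "row i A = 0" "det A \<noteq> 0"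
    then show "(\<integral>\<^sup>+x. \<bar>det A\<bar> * k (A *v x) \<partial>lborel) = (\<integral>\<^sup>+x. k x \<partial>lborel)"
      using det_zero_row(2) by blast
  next
    fix A :: "real ^ 'n ^ 'n" and k :: "real ^ 'n \<Rightarrow> ennreal"
    assume diag: "\<And>i j. i \<noteq> j \<Longrightarrow> A $ i $ j = 0" and "det A \<noteq> 0"
      and [measurable]: "k \<in> borel_measurable borel"
    then have det: "det A = (\<Prod>i\<in>UNIV. A $ i $ i)"
      by (simp add: det_diagonal)
    \<comment> \<open>On basis vectors \<open>c\<close> returns the diagonal entries of
      \<open>A\<close>. The affine rule for \<open>lborel\<close> takes its scaling factors indexed
      by \<open>Basis\<close>, not by \<open>'n\<close>.\<close>
    define c where "c b = (A *v b) \<bullet> b" for b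
    have c_axis: "c (axis i 1) = A $ i $ i" for i
      by (simp add: c_def inner_axis matrix_vector_mul_component)
    have Basis: "Basis = (\<lambda>i. axis i 1 :: real ^ 'n) ` UNIV" and inj: "inj (\<lambda>i. axis i 1 :: real ^ 'n)"
      by (auto simp: Basis_vec_def inj_on_def axis_eq_axis)
    have T: "(\<Sum>j\<in>Basis. (c j * (x \<bullet> j)) *\<^sub>R j) = A *v x" for x
    proof (subst vec_eq_iff, intro allI)
      fix i
      have "(\<Sum>j\<in>Basis. (c j * (x \<bullet> j)) *\<^sub>R j) $ i = A $ i $ i * x $ i"
        unfolding Basis sum.reindex[OF inj] o_def c_axis inner_axis
        by (simp add: axis_def if_distrib cong: if_cong)
      also have "\<dots> = (A *v x) $ i"
        by (subst matrix_vector_mult_def) (simp add: diag sum.remove[where x=i])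
      finally show "(\<Sum>j\<in>Basis. (c j * (x \<bullet> j)) *\<^sub>R j) $ i = (A *v x) $ i" .
    qed
    have "lborel = density (distr lborel borel (\<lambda>x. A *v x)) (\<lambda>_. (\<Prod>j\<in>Basis. \<bar>c j\<bar>))"
    proof -
      have "c j \<noteq> 0" if "j \<in> Basis" for j
        using that \<open>det A \<noteq> 0\<close> by (auto simp: Basis c_axis det)
      then show ?thesis
        using lborel_affine_euclidean[of c 0] by (simp add: T)
    qed
    also have "(\<Prod>j\<in>Basis. \<bar>c j\<bar>) = \<bar>det A\<bar>"
      by (simp add: Basis prod.reindex[OF inj] c_axis det abs_prod)
    finally have "(\<integral>\<^sup>+x. k x \<partial>lborel) = (\<integral>\<^sup>+x. k x \<partial>density (distr lborel borel (\<lambda>x. A *v x)) (\<lambda>_. \<bar>det A\<bar>))"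
      by simp
    then show "(\<integral>\<^sup>+x. \<bar>det A\<bar> * k (A *v x) \<partial>lborel) = (\<integral>\<^sup>+x. k x \<partial>lborel)"
      by (simp add: nn_integral_density nn_integral_distr)
  next
    fix m n :: 'n and k :: "real ^ 'n \<Rightarrow> ennreal"
    let ?\<tau> = "Transposition.transpose m n"
    let ?A = "\<chi> i j. mat 1 $ i $ ?\<tau> j :: real ^ 'n ^ 'n"
    assume "m \<noteq> n" and [measurable]: "k \<in> borel_measurable borel"
    have eq_\<tau>: "i = ?\<tau> j \<longleftrightarrow> ?\<tau> i = j" for i j
      by (metis transpose_involutory)
    have mult: "?A *v x = (\<chi> i. x $ ?\<tau> i)" for x
      by (simp add: vec_eq_iff matrix_vector_mult_def mat_def eq_\<tau> if_distrib [of "\<lambda>x. x * y" for y] cong: if_cong)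
    have "\<bar>det ?A\<bar> = 1"
      by (simp add: det_permute_columns permutes_swap_id sign_swap_id abs_mult)
    \<comment> \<open>Lebesgue measure is determined by its values on boxes. Swapping two
      coordinates turns a box into a box whose side lengths are permuted, which leaves the volume
      unchanged.\<close>
    have "lborel = distr lborel borel (\<lambda>x. ?A *v x)"
    proof (rule lborel_eqI)
      fix l u :: "real ^ 'n"
      assume le: "\<And>b. b \<in> Basis \<Longrightarrow> l \<bullet> b \<le> u \<bullet> b"
      show "emeasure (distr lborel borel (\<lambda>x. ?A *v x)) (box l u) = (\<Prod>b\<in>Basis. (u - l) \<bullet> b)"
      proof -
        have vimage: "(\<lambda>x. ?A *v x) -` box l u = box (\<chi> i. l $ ?\<tau> i) (\<chi> i. u $ ?\<tau> i)"
          unfolding mult by (auto simp: mem_box_cart) (metis transpose_involutory)+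
        have "axis i 1 \<in> (Basis :: (real ^ 'n) set)" for i
          by (simp add: axis_in_Basis_iff)
        with le have le': "l $ i \<le> u $ i" for i
          by (metis cart_eq_inner_axis)
        have "emeasure (distr lborel borel (\<lambda>x. ?A *v x)) (box l u) = (\<Prod>i\<in>UNIV. (u - l) $ ?\<tau> i)"
          using le'
          by (simp add: emeasure_distr vimage emeasure_lborel_box_eq Basis_vec_def inner_axis prod.UNION_disjoint axis_eq_axis)
        also have "(\<Prod>i\<in>UNIV. (u - l) $ ?\<tau> i) = (\<Prod>i\<in>UNIV. (u - l) $ i)"
          by (rule prod.permute[OF permutes_swap_id, symmetric, unfolded o_def]) auto
        also have "\<dots> = (\<Prod>b\<in>Basis. (u - l) \<bullet> b)"
          by (simp add: Basis_vec_def inner_axis prod.UNION_disjoint axis_eq_axis)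
        finally show ?thesis .
      qed
    qed simp
    then have "(\<integral>\<^sup>+x. k x \<partial>lborel) = (\<integral>\<^sup>+x. k x \<partial>distr lborel borel (\<lambda>x. ?A *v x))"
      by simp
    then show "(\<integral>\<^sup>+x. \<bar>det ?A\<bar> * k (?A *v x) \<partial>lborel) = (\<integral>\<^sup>+x. k x \<partial>lborel)"
      by (simp add: nn_integral_distr \<open>\<bar>det ?A\<bar> = 1\<close>)
  next
    fix m n :: 'n and k :: "real ^ 'n \<Rightarrow> ennreal"
    let ?A = "\<chi> i j. of_bool (i = m \<and> j = n \<or> i = j) :: real ^ 'n ^ 'n"
    assume "m \<noteq> n" and [measurable]: "k \<in> borel_measurable borel"
    have mult: "?A *v x = x + (x \<bullet> axis n 1) *\<^sub>R axis m 1" for x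
    proof (subst vec_eq_iff, intro allI)
      fix i
      show "(?A *v x) $ i = (x + (x \<bullet> axis n 1) *\<^sub>R axis m 1) $ i"
        using \<open>m \<noteq> n\<close> unfolding inner_axis
        by (cases "i = m") (simp_all add: matrix_vector_mult_def axis_def sum.remove[of _ m] of_bool_def if_distrib [of "\<lambda>x. x * y" for y] cong: if_cong)
    qed
    \<comment> \<open>\<open>?A\<close> arises from the identity by adding row \<open>n\<close> to
      row \<open>m\<close>, so its determinant is 1.\<close>
    have "?A = (\<chi> i. if i = m then row m (mat 1) + 1 *s row n (mat 1) else row i (mat 1))"
      using \<open>m \<noteq> n\<close> by (auto simp: vec_eq_iff row_def mat_def)
    then have "det ?A = 1"
      using \<open>m \<noteq> n\<close> by (simp add: det_row_operation del: vector_smult_lid)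
    then show "(\<integral>\<^sup>+x. \<bar>det ?A\<bar> * k (?A *v x) \<partial>lborel) = (\<integral>\<^sup>+x. k x \<partial>lborel)"
      using nn_integral_lborel_shear[of k "axis n 1" "axis m 1"] \<open>m \<noteq> n\<close>
      unfolding mult \<open>det ?A = 1\<close> by (simp add: axis_in_Basis_iff axis_eq_axis)
  qed
  with assms show ?thesis by blast
qed

section \<open>Tiling the space by lattice translates of the unit cube\<close>

text \<open>Hyperplanes are null sets. This allows the closed unit cube to be exchanged for the
  half-open one, whose translates are disjoint.\<close>

lemma AE_lborel_component_neq:
  fixes c :: real and i :: "'n::finite"
  shows "AE x in (lborel :: (real ^ 'n) measure). x $ i \<noteq> c"
proof -
  have "negligible {x :: real ^ 'n. x $ i = c}"
    using negligible_hyperplane[of "axis i (1::real)" c] by (simp add: inner_axis' axis_eq_0_iff)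
  then have "AE x in (lebesgue :: (real ^ 'n) measure). x \<notin> {x. x $ i = c}"
    by (intro AE_not_in) (simp add: negligible_iff_null_sets)
  then show ?thesis
    by (simp add: AE_completion_iff)
qed

text \<open>After sum and integral are interchanged, the term for \<open>m\<close> is the integral
  of \<open>k\<close> over the half-open cube translated by \<open>m\<close>. These translates
  partition the space, so the terms add up to the whole integral.\<close>

lemma nn_integral_lborel_tiling:
  fixes k :: "real ^ 'n \<Rightarrow> ennreal"
  assumes [measurable]: "k \<in> borel_measurable borel"
  shows "(\<integral>\<^sup>+v. (\<integral>\<^sup>+m. k (int_vec m + v) \<partial>count_space UNIV) * indicator (cbox 0 (\<chi> i. 1)) v \<partial>lborel) =
    (\<integral>\<^sup>+x. k x \<partial>lborel)"
proof -
  let ?C = "cbox 0 (\<chi> i. 1) :: (real ^ 'n) set"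
  define Q :: "(real ^ 'n) set" where "Q = {v. \<forall>i. 0 \<le> v $ i \<and> v $ i < 1}"
  have [measurable]: "Q \<in> sets borel"
    unfolding Q_def by measurable
  \<comment> \<open>The two cubes differ only on the faces where some coordinate equals 1.\<close>
  have "AE v in lborel. indicator ?C v = (indicator Q v :: ennreal)"
  proof -
    have "AE v in lborel. \<forall>i\<in>UNIV. (v :: real ^ 'n) $ i \<noteq> 1"
      by (rule AE_finite_allI) (auto intro: AE_lborel_component_neq)
    then show ?thesis
      by eventually_elim (auto simp: Q_def mem_box_cart indicator_def less_le)
  qed
  then have "(\<integral>\<^sup>+v. (\<integral>\<^sup>+m. k (int_vec m + v) \<partial>count_space UNIV) * indicator ?C v \<partial>lborel) =
      (\<integral>\<^sup>+v. (\<integral>\<^sup>+m. k (int_vec m + v) \<partial>count_space UNIV) * indicator Q v \<partial>lborel)"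
    by (intro nn_integral_cong_AE) auto
  also have "\<dots> = (\<integral>\<^sup>+v. \<integral>\<^sup>+m. k (int_vec m + v) * indicator Q v \<partial>count_space UNIV \<partial>lborel)"
    by (simp add: nn_integral_multc)
  also have "\<dots> = (\<integral>\<^sup>+m. \<integral>\<^sup>+v. k (int_vec m + v) * indicator Q v \<partial>lborel \<partial>count_space UNIV)"
    by (rule nn_integral_count_space_nn_integral) auto
  also have "\<dots> = (\<integral>\<^sup>+m. \<integral>\<^sup>+x. k x * indicator Q (x - int_vec m) \<partial>lborel \<partial>count_space UNIV)"
  proof (rule nn_integral_cong)
    fix m :: "int ^ 'n"
    have "(\<integral>\<^sup>+x. k x * indicator Q (x - int_vec m) \<partial>lborel) =
        (\<integral>\<^sup>+x. k x * indicator Q (x - int_vec m) \<partial>distr lborel borel ((+) (int_vec m)))"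
      by (simp add: lborel_distr_plus)
    then show "(\<integral>\<^sup>+v. k (int_vec m + v) * indicator Q v \<partial>lborel) =
        (\<integral>\<^sup>+x. k x * indicator Q (x - int_vec m) \<partial>lborel)"
      by (simp add: nn_integral_distr)
  qed
  also have "\<dots> = (\<integral>\<^sup>+x. \<integral>\<^sup>+m. k x * indicator Q (x - int_vec m) \<partial>count_space UNIV \<partial>lborel)"
    by (rule nn_integral_count_space_nn_integral[symmetric]) auto
  also have "\<dots> = (\<integral>\<^sup>+x. k x \<partial>lborel)"
  proof (rule nn_integral_cong)
    fix x :: "real ^ 'n"
    \<comment> \<open>The coordinatewise floor of \<open>x\<close> indexes the only translate that
      contains \<open>x\<close>, so the sum over \<open>m\<close> has a single nonzero
      indicator.\<close>
    have "x - int_vec m \<in> Q \<longleftrightarrow> m = (\<chi> i. \<lfloor>x $ i\<rfloor>)" for m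
    proof -
      have "0 \<le> x $ i - of_int (m $ i) \<and> x $ i - of_int (m $ i) < 1 \<longleftrightarrow> m $ i = \<lfloor>x $ i\<rfloor>" for i
        by (auto simp: eq_commute[of "m $ i"] floor_eq_iff)
      then show ?thesis
        by (simp add: Q_def int_vec_def vec_eq_iff)
    qed
    then have "(\<integral>\<^sup>+m. k x * indicator Q (x - int_vec m) \<partial>count_space UNIV) =
        (\<integral>\<^sup>+m. k x * indicator {\<chi> i. \<lfloor>x $ i\<rfloor>} m \<partial>count_space UNIV)"
      by (intro nn_integral_cong) (simp add: indicator_def)
    then show "(\<integral>\<^sup>+m. k x * indicator Q (x - int_vec m) \<partial>count_space UNIV) = k x"
      by simp
  qed
  finally show ?thesis .
qed

text \<open>The tiling identity is applied to \<open>h\<close> pulled back along \<open>A\<close>.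
  The factor \<open>\<bar>det A\<bar>\<close> compensates the substitution, so the result is the
  same for all such \<open>A\<close>.\<close>

lemma nn_integral_lattice_sum:
  fixes A :: "real ^ 'n ^ 'n" and h :: "real ^ 'n \<Rightarrow> ennreal"
  assumes "det A \<noteq> 0" and [measurable]: "h \<in> borel_measurable borel"
  shows "(\<integral>\<^sup>+v. (\<integral>\<^sup>+m. \<bar>det A\<bar> * h (A *v (int_vec m + v)) \<partial>count_space UNIV)
      * indicator (cbox 0 (\<chi> i. 1)) v \<partial>lborel) = (\<integral>\<^sup>+x. h x \<partial>lborel)"
proof -
  have [measurable]: "(\<lambda>x. A *v x) \<in> borel_measurable borel"
    by (simp add: borel_measurable_continuous_onI matrix_vector_mult_linear_continuous_on)
  show ?thesis
    using nn_integral_lborel_tiling[of "\<lambda>x. \<bar>det A\<bar> * h (A *v x)"] nn_integral_lborel_matrix[OF assms]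
    by simp
qed

section \<open>Measurability and almost sure modification\<close>

lemma borel_measurable_matrix_vector_mult [measurable (raw)]:
  fixes A :: "'a \<Rightarrow> real ^ 'n ^ 'm"
  assumes "A \<in> borel_measurable M" and "x \<in> borel_measurable M"
  shows "(\<lambda>\<omega>. A \<omega> *v x \<omega>) \<in> borel_measurable M"
  using assms
proof (rule borel_measurable_continuous_Pair)
  show "continuous_on UNIV (\<lambda>p :: (real ^ 'n ^ 'm) \<times> (real ^ 'n). fst p *v snd p)"
    unfolding matrix_vector_mult_def by (intro continuous_intros)
qed

lemma borel_measurable_det [measurable (raw)]:
  fixes A :: "'a \<Rightarrow> real ^ 'n ^ 'n"
  assumes "A \<in> borel_measurable M"
  shows "(\<lambda>\<omega>. det (A \<omega>)) \<in> borel_measurable M"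
proof -
  have "continuous_on UNIV (det :: real ^ 'n ^ 'n \<Rightarrow> real)"
    unfolding det_def by (intro continuous_intros)
  from measurable_compose[OF assms borel_measurable_continuous_onI[OF this]] show ?thesis .
qed

text \<open>Preimages under \<open>f\<close> and \<open>g\<close> differ only inside a null set, and
  the completion contains all subsets of null sets. Measurability of \<open>f\<close> is thus a
  conclusion.\<close>

lemma borel_measurable_completion_cong_AE:
  fixes f g :: "'a \<Rightarrow> 'b :: topological_space"
  assumes g: "g \<in> borel_measurable (completion M)" and ae: "AE x in M. f x = g x"
  shows "f \<in> borel_measurable (completion M)"
proof (rule measurableI)
  fix A :: "'b set"
  assume "A \<in> sets borel"
  with g have "g -` A \<inter> space M \<in> sets (completion M)"
    using measurable_sets[of g "completion M" borel A] by simp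
  moreover have "AE x in completion M. x \<in> g -` A \<inter> space M \<longleftrightarrow> x \<in> f -` A \<inter> space M"
    using AE_completion[OF ae] by eventually_elim auto
  ultimately show "f -` A \<inter> space (completion M) \<in> sets (completion M)"
    by (simp add: completion.in_sets_AE[where A = "g -` A \<inter> space M"])
qed simp

text \<open>This carries an expectation from a measurable variable over to one known only to agree
  with it almost surely, such as the lattice sum of a merely Lebesgue measurable function.\<close>

lemma has_expectation_cong_AE:
  assumes Y: "has_expectation M Y a" and XY: "AE \<omega> in M. X \<omega> = Y \<omega>"
  shows "has_expectation M X a"
proof -
  have Y_meas: "Y \<in> borel_measurable (completion M)"
    using Y by (auto simp: has_expectation_def)
  note X_meas = borel_measurable_completion_cong_AE[OF Y_meas XY]
  have "integrable (completion M) X \<longleftrightarrow> integrable (completion M) Y"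
    using AE_completion[OF XY] X_meas Y_meas by (intro integrable_cong_AE)
  moreover have "integral\<^sup>L (completion M) X = integral\<^sup>L (completion M) Y"
    using AE_completion[OF XY] X_meas Y_meas by (intro integral_cong_AE)
  ultimately show ?thesis
    using Y by (simp add: has_expectation_def)
qed

section \<open>Expectation of the randomly shifted lattice sum\<close>

text \<open>
  \<open>U\<close> and \<open>V\<close> share a type because \<open>indep_var\<close> demands it, so the random matrix enters as a Borel
  function of \<open>U\<close>.
\<close>
lemma (in prob_space) nn_integral_random_lattice_sum:
  fixes U V :: "'a \<Rightarrow> real ^ 'n" and A :: "real ^ 'n \<Rightarrow> real ^ 'n ^ 'n" and h :: "real ^ 'n \<Rightarrow> ennreal"
  assumes V: "uniformly_distributed M V (cbox 0 (\<chi> i. 1))"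
    and indep: "indep_var borel U borel V"
    and inv: "AE \<omega> in M. det (A (U \<omega>)) \<noteq> 0"
    and [measurable]: "A \<in> borel_measurable borel" "h \<in> borel_measurable borel"
  shows "(\<integral>\<^sup>+\<omega>. \<integral>\<^sup>+m. \<bar>det (A (U \<omega>))\<bar> * h (A (U \<omega>) *v (int_vec m + V \<omega>)) \<partial>count_space UNIV \<partial>M) =
      (\<integral>\<^sup>+x. h x \<partial>lborel)"
    and "(\<lambda>\<omega>. \<integral>\<^sup>+m. \<bar>det (A (U \<omega>))\<bar> * h (A (U \<omega>) *v (int_vec m + V \<omega>)) \<partial>count_space UNIV)
      \<in> borel_measurable M"
proof -
  let ?C = "cbox 0 (\<chi> i. 1) :: (real ^ 'n) set"
  \<comment> \<open>Written as a function of a pair, the lattice sum can be integrated against the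
    joint law of \<open>U\<close> and \<open>V\<close>, which independence makes a product.\<close>
  define F where "F p = (\<integral>\<^sup>+m. \<bar>det (A (fst p))\<bar> * h (A (fst p) *v (int_vec m + snd p)) \<partial>count_space UNIV)"
    for p :: "(real ^ 'n) \<times> (real ^ 'n)"
  have [measurable]: "random_variable borel U" "random_variable borel V"
    and joint: "distr M borel U \<Otimes>\<^sub>M distr M borel V = distr M (borel \<Otimes>\<^sub>M borel) (\<lambda>\<omega>. (U \<omega>, V \<omega>))"
    using indep by (auto simp: indep_var_distribution_eq)
  interpret V: prob_space "distr M borel V"
    by (rule prob_space_distr) simp
  interpret count: sigma_finite_measure "count_space (UNIV :: (int ^ 'n) set)"
    by (rule sigma_finite_measure_count_space)
  \<comment> \<open>The lattice is countable, so joint measurability follows from measurability for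
    each fixed \<open>m\<close>.\<close>
  have "(\<lambda>q. ennreal \<bar>det (A (fst (snd q)))\<bar> * h (A (fst (snd q)) *v (int_vec (fst q) + snd (snd q))))
      \<in> borel_measurable (count_space UNIV \<Otimes>\<^sub>M (borel \<Otimes>\<^sub>M borel))"
    by (rule measurable_pair_measure_countable1) auto
  from measurable_compose[OF measurable_pair_swap' this]
  have F[measurable]: "F \<in> borel_measurable (borel \<Otimes>\<^sub>M borel)"
    unfolding F_def by (intro count.borel_measurable_nn_integral) (simp add: split_beta')
  \<comment> \<open>The cube has volume 1, so the density of \<open>V\<close> is just its
    indicator.\<close>
  have content_C: "measure lborel ?C = 1"
    by (simp add: content_cbox_if_cart interval_ne_empty_cart)
  then have distr_V: "distr M borel V = density lborel (indicator ?C)"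
    using V by (simp add: uniformly_distributed_def distributed_def ennreal_indicator cong: distr_cong)
  have F_V: "(\<integral>\<^sup>+v. F (u, v) \<partial>distr M borel V) = (\<integral>\<^sup>+x. h x \<partial>lborel)" if "det (A u) \<noteq> 0" for u
    using nn_integral_lattice_sum[OF that, of h]
    by (simp add: distr_V nn_integral_density F_def mult.commute)
  have "(\<integral>\<^sup>+\<omega>. F (U \<omega>, V \<omega>) \<partial>M) = (\<integral>\<^sup>+p. F p \<partial>(distr M borel U \<Otimes>\<^sub>M distr M borel V))"
    by (simp add: joint nn_integral_distr)
  also have "\<dots> = (\<integral>\<^sup>+u. \<integral>\<^sup>+v. F (u, v) \<partial>distr M borel V \<partial>distr M borel U)"
    by (simp add: V.nn_integral_fst)
  also have "\<dots> = (\<integral>\<^sup>+\<omega>. \<integral>\<^sup>+v. F (U \<omega>, v) \<partial>distr M borel V \<partial>M)"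
    by (simp add: nn_integral_distr)
  also have "\<dots> = (\<integral>\<^sup>+\<omega>. (\<integral>\<^sup>+x. h x \<partial>lborel) \<partial>M)"
    using inv by (intro nn_integral_cong_AE) (auto simp: F_V)
  finally show "(\<integral>\<^sup>+\<omega>. \<integral>\<^sup>+m. \<bar>det (A (U \<omega>))\<bar> * h (A (U \<omega>) *v (int_vec m + V \<omega>)) \<partial>count_space UNIV \<partial>M) =
      (\<integral>\<^sup>+x. h x \<partial>lborel)"
    by (simp add: F_def emeasure_space_1)
  have "(\<lambda>\<omega>. F (U \<omega>, V \<omega>)) \<in> borel_measurable M"
    by measurable
  then show "(\<lambda>\<omega>. \<integral>\<^sup>+m. \<bar>det (A (U \<omega>))\<bar> * h (A (U \<omega>) *v (int_vec m + V \<omega>)) \<partial>count_space UNIV)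
      \<in> borel_measurable M"
    by (simp add: F_def)
qed

text \<open>Unordered summation of an absolutely summable family is integration for the counting
  measure, and that integral splits into positive and negative part. \<open>ennreal\<close> maps
  negative numbers to 0 and thereby cuts out the two parts.\<close>

lemma infsum_eq_enn2real_diff:
  fixes q :: "'i \<Rightarrow> real"
  assumes "(\<integral>\<^sup>+m. ennreal \<bar>q m\<bar> \<partial>count_space UNIV) < \<infinity>"
  shows "(\<lambda>m. \<bar>q m\<bar>) summable_on UNIV"
    and "(\<Sum>\<^sub>\<infinity>m. q m) =
      enn2real (\<integral>\<^sup>+m. ennreal (q m) \<partial>count_space UNIV) - enn2real (\<integral>\<^sup>+m. ennreal (- q m) \<partial>count_space UNIV)"
proof -
  have int: "integrable (count_space UNIV) q"
    using assms by (simp add: integrable_iff_bounded)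
  then have abs: "Infinite_Set_Sum.abs_summable_on q UNIV"
    by (simp add: Infinite_Set_Sum.abs_summable_on_def)
  then show "(\<lambda>m. \<bar>q m\<bar>) summable_on UNIV"
    by (simp flip: abs_summable_equivalent)
  show "(\<Sum>\<^sub>\<infinity>m. q m) =
      enn2real (\<integral>\<^sup>+m. ennreal (q m) \<partial>count_space UNIV) - enn2real (\<integral>\<^sup>+m. ennreal (- q m) \<partial>count_space UNIV)"
    using real_lebesgue_integral_def[OF int] infsetsum_infsum[OF abs] by (simp add: infsetsum_def)
qed

text \<open>\<open>enn2real\<close> sends infinity to 0, but a finite integral confines infinite
  values to a null set, so nothing is lost.\<close>

lemma has_bochner_integral_enn2real:
  fixes F :: "'a \<Rightarrow> ennreal"
  assumes [measurable]: "F \<in> borel_measurable M" and fin: "(\<integral>\<^sup>+x. F x \<partial>M) < \<infinity>"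
  shows "has_bochner_integral M (\<lambda>x. enn2real (F x)) (enn2real (\<integral>\<^sup>+x. F x \<partial>M))"
proof (rule has_bochner_integral_nn_integral)
  have "AE x in M. F x \<noteq> \<infinity>"
    using fin by (intro nn_integral_noteq_infinite) auto
  then have "(\<integral>\<^sup>+x. ennreal (enn2real (F x)) \<partial>M) = (\<integral>\<^sup>+x. F x \<partial>M)"
    by (intro nn_integral_cong_AE) (auto simp: less_top)
  also have "\<dots> = ennreal (enn2real (\<integral>\<^sup>+x. F x \<partial>M))"
    using fin by simp
  finally show "(\<integral>\<^sup>+x. ennreal (enn2real (F x)) \<partial>M) = ennreal (enn2real (\<integral>\<^sup>+x. F x \<partial>M))" .
qed auto

lemma (in prob_space) random_lattice_sum_unbiased:
  fixes U V :: "'a \<Rightarrow> real ^ 'n" and A :: "real ^ 'n \<Rightarrow> real ^ 'n ^ 'n" and f :: "real ^ 'n \<Rightarrow> real"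
  assumes V: "uniformly_distributed M V (cbox 0 (\<chi> i. 1))"
    and indep: "indep_var borel U borel V"
    and inv: "AE \<omega> in M. det (A (U \<omega>)) \<noteq> 0"
    and A: "A \<in> borel_measurable borel"
    and f: "integrable lebesgue f"
  shows "AE \<omega> in M. (\<lambda>m. \<bar>f (A (U \<omega>) *v (int_vec m + V \<omega>))\<bar>) summable_on UNIV" (is ?summable)
    and "has_expectation M (\<lambda>\<omega>. \<bar>det (A (U \<omega>))\<bar> * (\<Sum>\<^sub>\<infinity>m. f (A (U \<omega>) *v (int_vec m + V \<omega>))))
      (integral\<^sup>L lebesgue f)" (is ?expectation)
proof -
  define y where "y \<omega> m = A (U \<omega>) *v (int_vec m + V \<omega>)" for \<omega> m
  define L where "L h \<omega> = (\<integral>\<^sup>+m. \<bar>det (A (U \<omega>))\<bar> * h (y \<omega> m) \<partial>count_space UNIV)"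
    for h :: "real ^ 'n \<Rightarrow> ennreal" and \<omega>
  have L: "(\<integral>\<^sup>+\<omega>. L h \<omega> \<partial>M) = (\<integral>\<^sup>+x. h x \<partial>lborel)" "L h \<in> borel_measurable M"
    if "h \<in> borel_measurable borel" for h
    using nn_integral_random_lattice_sum[OF V indep inv A that] unfolding L_def y_def by auto
  obtain g where [measurable]: "g \<in> borel_measurable borel" and ae: "AE x in lborel. f x = g x"
    using completion_ex_borel_measurable_real[of f lborel] borel_measurable_integrable[OF f] by auto
  have fg: "AE x in lebesgue. f x = g x"
    using ae by (rule AE_completion)
  then have "integrable lebesgue g"
    using f by (subst integrable_cong_AE[of g lebesgue f]) (auto intro: measurable_completion)
  then have g: "integrable lborel g"
    by (simp add: integrable_completion)
  have "integral\<^sup>L lebesgue f = integral\<^sup>L lebesgue g"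
    using fg f by (intro integral_cong_AE) (auto intro: measurable_completion)
  also have "\<dots> = integral\<^sup>L lborel g"
    by (simp add: integral_completion)
  finally have integral_f: "integral\<^sup>L lebesgue f = integral\<^sup>L lborel g" .

  \<comment> \<open>The set where \<open>f\<close> and \<open>g\<close> differ need not be Borel,
    hence the passage to a Borel null set around it.\<close>
  obtain N where N: "{x. f x \<noteq> g x} \<subseteq> N" "N \<in> null_sets lborel"
    using ae by (elim AE_E) (auto simp: null_sets_def)
  then have [measurable]: "N \<in> sets borel"
    by auto
  have "AE \<omega> in M. L (indicator N) \<omega> = 0"
    using L[of "indicator N"] N by (subst nn_integral_0_iff_AE[symmetric]) auto
  then have nodes: "AE \<omega> in M. \<forall>m. f (y \<omega> m) = g (y \<omega> m)"
    using inv
  proof eventually_elim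
    case (elim \<omega>)
    \<comment> \<open>A vanishing sum of nonnegative terms forces each term to vanish, and the
      determinant factor is nonzero, so every indicator is 0.\<close>
    then have "\<forall>m. y \<omega> m \<notin> N"
      by (auto simp: L_def nn_integral_0_iff_AE AE_count_space indicator_def split: if_splits)
    with N show ?case by auto
  qed
  have g_fin: "(\<integral>\<^sup>+x. ennreal \<bar>g x\<bar> \<partial>lborel) < \<infinity>"
    using g by (simp add: integrable_iff_bounded)
  have "AE \<omega> in M. L (\<lambda>x. ennreal \<bar>g x\<bar>) \<omega> \<noteq> \<infinity>"
    using g_fin by (intro nn_integral_noteq_infinite) (auto simp: L)
  with inv nodes have "AE \<omega> in M. (\<lambda>m. \<bar>f (y \<omega> m)\<bar>) summable_on UNIV \<and>
      \<bar>det (A (U \<omega>))\<bar> * (\<Sum>\<^sub>\<infinity>m. f (y \<omega> m)) = enn2real (L (\<lambda>x. g x) \<omega>) - enn2real (L (\<lambda>x. - g x) \<omega>)"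
  proof eventually_elim
    case (elim \<omega>)
    let ?d = "\<bar>det (A (U \<omega>))\<bar>"
    have L_eq: "L (\<lambda>x. ennreal (h x)) \<omega> = (\<integral>\<^sup>+m. ennreal (?d * h (y \<omega> m)) \<partial>count_space UNIV)" for h
      by (simp add: L_def ennreal_mult')
    have "(\<integral>\<^sup>+m. ennreal \<bar>?d * g (y \<omega> m)\<bar> \<partial>count_space UNIV) < \<infinity>"
      using elim by (simp add: L_eq abs_mult less_top)
    from infsum_eq_enn2real_diff[OF this]
    have "(\<lambda>m. \<bar>?d * g (y \<omega> m)\<bar>) summable_on UNIV"
      and "(\<Sum>\<^sub>\<infinity>m. ?d * g (y \<omega> m)) = enn2real (L (\<lambda>x. g x) \<omega>) - enn2real (L (\<lambda>x. - g x) \<omega>)"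
      by (simp_all add: L_eq)
    moreover have "f (y \<omega> m) = g (y \<omega> m)" for m
      using elim by simp
    ultimately show ?case
      using elim by (simp add: abs_mult summable_on_cmult_right' infsum_cmult_right')
  qed
  then have summable: "AE \<omega> in M. (\<lambda>m. \<bar>f (y \<omega> m)\<bar>) summable_on UNIV"
    and Q: "AE \<omega> in M. \<bar>det (A (U \<omega>))\<bar> * (\<Sum>\<^sub>\<infinity>m. f (y \<omega> m)) =
      enn2real (L (\<lambda>x. g x) \<omega>) - enn2real (L (\<lambda>x. - g x) \<omega>)"
    by auto
  from summable show ?summable
    by (simp add: y_def)

  have "(\<integral>\<^sup>+x. ennreal (g x) \<partial>lborel) < \<infinity>" "(\<integral>\<^sup>+x. ennreal (- g x) \<partial>lborel) < \<infinity>"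
    by (rule le_less_trans[OF nn_integral_mono g_fin]; simp add: ennreal_leI)+
  then have "has_bochner_integral M (\<lambda>\<omega>. enn2real (L (\<lambda>x. g x) \<omega>) - enn2real (L (\<lambda>x. - g x) \<omega>))
      (enn2real (\<integral>\<^sup>+x. ennreal (g x) \<partial>lborel) - enn2real (\<integral>\<^sup>+x. ennreal (- g x) \<partial>lborel))"
    using has_bochner_integral_enn2real[of "L (\<lambda>x. g x)" M] has_bochner_integral_enn2real[of "L (\<lambda>x. - g x)" M]
    by (intro has_bochner_integral_diff) (simp_all add: L)
  then have D: "has_bochner_integral M (\<lambda>\<omega>. enn2real (L (\<lambda>x. g x) \<omega>) - enn2real (L (\<lambda>x. - g x) \<omega>))
      (integral\<^sup>L lebesgue f)"
    by (simp add: integral_f real_lebesgue_integral_def[OF g])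
  then have D_meas: "(\<lambda>\<omega>. enn2real (L (\<lambda>x. g x) \<omega>) - enn2real (L (\<lambda>x. - g x) \<omega>)) \<in> borel_measurable M"
    by (auto simp: has_bochner_integral_iff)
  \<comment> \<open>The difference is measurable for \<open>M\<close> itself, so its integral is
    unchanged under completion. Only the replacement by the sum over \<open>f\<close> requires the
    completed measure.\<close>
  then have "has_expectation M (\<lambda>\<omega>. enn2real (L (\<lambda>x. g x) \<omega>) - enn2real (L (\<lambda>x. - g x) \<omega>))
      (integral\<^sup>L lebesgue f)"
    using D by (simp add: has_expectation_def has_bochner_integral_iff
        integrable_completion[OF D_meas] integral_completion[OF D_meas])
  from has_expectation_cong_AE[OF this Q] show ?expectation
    by (simp add: y_def)
qed

section \<open>Reduction of the quadrature rule to the lattice sum\<close>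

text \<open>This makes a deterministic matrix a special case of a random one. The law of a constant
  is a point mass, so the product formula can be checked on rectangles.\<close>

lemma (in prob_space) indep_var_const:
  assumes "random_variable T Y" and "c \<in> space S"
  shows "indep_var S (\<lambda>_. c) T Y"
  unfolding indep_var_distribution_eq
proof (intro conjI)
  interpret Y: prob_space "distr M T Y"
    by (rule prob_space_distr) fact
  interpret const: prob_space "distr M S (\<lambda>_. c)"
    by (rule prob_space_distr) (simp add: assms)
  show "distr M S (\<lambda>_. c) \<Otimes>\<^sub>M distr M T Y = distr M (S \<Otimes>\<^sub>M T) (\<lambda>\<omega>. (c, Y \<omega>))"
  proof (rule pair_measure_eqI)
    show "sigma_finite_measure (distr M S (\<lambda>_. c))" "sigma_finite_measure (distr M T Y)" ..
  next
    fix A B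
    assume "A \<in> sets (distr M S (\<lambda>_. c))" and "B \<in> sets (distr M T Y)"
    then have AB: "A \<in> sets S" "B \<in> sets T" by auto
    have "(\<lambda>\<omega>. (c, Y \<omega>)) -` (A \<times> B) \<inter> space M = (if c \<in> A then Y -` B \<inter> space M else {})"
      and "(\<lambda>_. c) -` A \<inter> space M = (if c \<in> A then space M else {})"
      by auto
    with AB show "emeasure (distr M S (\<lambda>_. c)) A * emeasure (distr M T Y) B =
        emeasure (distr M (S \<Otimes>\<^sub>M T) (\<lambda>\<omega>. (c, Y \<omega>))) (A \<times> B)"
      using assms by (simp add: emeasure_distr emeasure_space_1)
  qed simp
qed (use assms in auto)

text \<open>\<open>matrix_inv\<close> is defined by choice. For square matrices a right inverse is
  also a left inverse, which pins the chosen matrix down.\<close>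

lemma matrix_inv_unique:
  fixes A B :: "real ^ 'n ^ 'n"
  assumes "A ** B = mat 1"
  shows "invertible A" and "matrix_inv A = B"
proof -
  have BA: "B ** A = mat 1"
    using assms by (simp add: matrix_left_right_inverse)
  with assms show "invertible A"
    by (auto simp: invertible_def)
  have "A ** matrix_inv A = mat 1"
    unfolding matrix_inv_def by (rule someI2[where a=B]) (use assms BA in auto)
  then have "B ** (A ** matrix_inv A) = B"
    by simp
  then show "matrix_inv A = B"
    by (simp add: matrix_mul_assoc BA)
qed

lemma invertible_matrix_inv:
  fixes S :: "real ^ 'n ^ 'n"
  assumes "invertible S"
  shows "S ** matrix_inv S = mat 1"
  using assms matrix_inv_unique(2) by (auto simp: invertible_def)

text \<open>Any explicit right inverse \<open>R\<close> may replace \<open>matrix_inv S\<close>, and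
  \<open>1 / \<bar>det S\<bar>\<close> becomes the factor
  \<open>\<bar>det (transpose R)\<bar>\<close> of the lattice sum.\<close>

lemma quad_rule_eq_lattice_sum:
  fixes S R :: "real ^ 'n ^ 'n"
  assumes SR: "S ** R = mat 1"
  shows "quad_rule S v f = \<bar>det (transpose R)\<bar> * (\<Sum>\<^sub>\<infinity>m. f (transpose R *v (int_vec m + v)))"
    and "quad_rule_defined S v f \<longleftrightarrow> (\<lambda>m. \<bar>f (transpose R *v (int_vec m + v))\<bar>) summable_on UNIV"
    and "det (transpose R) \<noteq> 0"
proof -
  have det: "det S * det R = 1"
    using SR by (metis det_I det_mul)
  then have "1 / \<bar>det S\<bar> = \<bar>det R\<bar>"
    by (metis abs_mult abs_one div_by_0 nonzero_eq_divide_eq mult.commute mult_zero_left abs_zero zero_neq_one)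
  then show "quad_rule S v f = \<bar>det (transpose R)\<bar> * (\<Sum>\<^sub>\<infinity>m. f (transpose R *v (int_vec m + v)))"
    by (simp only: quad_rule_def node_def matrix_inv_unique(2)[OF SR] det_transpose)
  show "quad_rule_defined S v f \<longleftrightarrow> (\<lambda>m. \<bar>f (transpose R *v (int_vec m + v))\<bar>) summable_on UNIV"
    by (simp only: quad_rule_defined_def node_def matrix_inv_unique[OF SR] simp_thms)
  show "det (transpose R) \<noteq> 0"
    using det by (auto simp: det_transpose)
qed

text \<open>The inverse enters as a separate function \<open>R\<close> with Borel entries, which
  supplies the measurability of the random lattice. The almost sure identity in \<open>inv\<close>
  ties it to \<open>S\<close>.\<close>

lemma (in prob_space) quad_rule_unbiased:
  fixes U V :: "'a \<Rightarrow> real ^ 'n" and S R :: "real ^ 'n \<Rightarrow> real ^ 'n ^ 'n" and f :: "real ^ 'n \<Rightarrow> real"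
  assumes V: "uniformly_distributed M V (cbox 0 (\<chi> i. 1))"
    and indep: "indep_var borel U borel V"
    and inv: "AE \<omega> in M. S (U \<omega>) ** R (U \<omega>) = mat 1"
    and R: "\<And>i j. (\<lambda>u. R u $ i $ j) \<in> borel_measurable borel"
    and f: "integrable lebesgue f"
  shows "AE \<omega> in M. quad_rule_defined (S (U \<omega>)) (V \<omega>) f"
    and "has_expectation M (\<lambda>\<omega>. quad_rule (S (U \<omega>)) (V \<omega>) f) (integral\<^sup>L lebesgue f)"
proof -
  let ?Q = "\<lambda>\<omega>. \<bar>det (transpose (R (U \<omega>)))\<bar> * (\<Sum>\<^sub>\<infinity>m. f (transpose (R (U \<omega>)) *v (int_vec m + V \<omega>)))"
  have "(\<lambda>u. transpose (R u)) \<in> borel_measurable borel"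
    using R by (subst borel_measurable_euclidean_space) (auto simp: Basis_vec_def inner_axis transpose_def)
  moreover have "AE \<omega> in M. det (transpose (R (U \<omega>))) \<noteq> 0"
    using inv by eventually_elim (rule quad_rule_eq_lattice_sum)
  ultimately have unbiased: "AE \<omega> in M. (\<lambda>m. \<bar>f (transpose (R (U \<omega>)) *v (int_vec m + V \<omega>))\<bar>) summable_on UNIV"
    "has_expectation M ?Q (integral\<^sup>L lebesgue f)"
    using random_lattice_sum_unbiased[OF V indep _ _ f, of "\<lambda>u. transpose (R u)"]
    by (simp_all del: transpose_matrix_vector)
  show "AE \<omega> in M. quad_rule_defined (S (U \<omega>)) (V \<omega>) f"
    using inv unbiased(1) by eventually_elim (simp only: quad_rule_eq_lattice_sum)
  have "AE \<omega> in M. quad_rule (S (U \<omega>)) (V \<omega>) f = ?Q \<omega>"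
    using inv by eventually_elim (rule quad_rule_eq_lattice_sum)
  then show "has_expectation M (\<lambda>\<omega>. quad_rule (S (U \<omega>)) (V \<omega>) f) (integral\<^sup>L lebesgue f)"
    using unbiased(2) by (rule has_expectation_cong_AE[rotated])
qed

section \<open>The randomly dilated matrix and the unbiasedness theorem\<close>

text \<open>Inverting the product reverses its order, so column \<open>j\<close> of the inverse of
  \<open>B\<close> is divided by \<open>c * u $ j\<close>. Spelled out by entries, the inverse is
  visibly Borel in \<open>u\<close>.\<close>

lemma scaled_diag_matrix_right_inverse:
  fixes B :: "real ^ 'n ^ 'n"
  assumes "invertible B" and "c \<noteq> 0" and "\<And>i. u $ i \<noteq> 0"
  shows "(c *\<^sub>R (diag_matrix u ** B)) ** (\<chi> i j. matrix_inv B $ i $ j / (c * u $ j)) = mat 1"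
proof -
  have "(\<chi> i j. matrix_inv B $ i $ j / (c * u $ j)) = (1 / c) *\<^sub>R (matrix_inv B ** diag_matrix (\<chi> j. 1 / u $ j))"
    by (simp add: vec_eq_iff matrix_matrix_mult_def diag_matrix_def if_distrib cong: if_cong)
  moreover have "diag_matrix u ** diag_matrix (\<chi> j. 1 / u $ j) = mat 1"
    using assms(3) by (simp add: vec_eq_iff matrix_matrix_mult_def diag_matrix_def mat_def
        if_distrib [of "\<lambda>x. x * y" for y] cong: if_cong)
  then have "diag_matrix u ** (B ** matrix_inv B) ** diag_matrix (\<chi> j. 1 / u $ j) = mat 1"
    using assms(1) by (simp add: invertible_matrix_inv)
  ultimately show ?thesis
    using \<open>c \<noteq> 0\<close> by (simp add: matrix_scalar_ac matrix_mul_assoc flip: scalar_matrix_assoc)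
qed

text \<open>The density vanishes outside \<open>A\<close>.\<close>

lemma uniformly_distributed_AE:
  assumes "uniformly_distributed M X A" and [measurable]: "A \<in> sets borel"
  shows "AE \<omega> in M. X \<omega> \<in> A"
proof -
  have X_meas: "X \<in> measurable M lborel"
    and X: "distr M lborel X = density lborel (\<lambda>x. ennreal (indicator A x / measure lborel A))"
    using assms by (auto simp: uniformly_distributed_def distributed_def)
  have "AE x in distr M lborel X. x \<in> A"
    unfolding X by (subst AE_density) (auto split: split_indicator)
  then show ?thesis
    by (rule AE_distrD[where M' = lborel, rotated]) (rule X_meas)
qed

theorem proposition1:
  fixes M :: "'w measure" and V :: "'w \<Rightarrow> real ^ 'n"
  assumes "prob_space M"
    and "uniformly_distributed M V (cbox 0 (\<chi> i. 1))"
  shows "(\<forall>(S :: real ^ 'n ^ 'n) f. invertible S \<longrightarrow> integrable lebesgue f \<longrightarrow>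
            (AE \<omega> in M. quad_rule_defined S (V \<omega>) f) \<and>
            has_expectation M (\<lambda>\<omega>. quad_rule S (V \<omega>) f) (integral\<^sup>L lebesgue f))
       \<and> (\<forall>(B :: real ^ 'n ^ 'n) (n :: nat) U.
            frolov_matrix B \<longrightarrow> n \<ge> 1 \<longrightarrow>
            uniformly_distributed M U (cbox (\<chi> i. 1) (\<chi> i. 2 powr (1 / real CARD('n)))) \<longrightarrow>
            prob_space.indep_var M borel U borel V \<longrightarrow>
            (\<forall>f. integrable lebesgue f \<longrightarrow>
               (AE \<omega> in M. quad_rule_defined
                  (real n powr (1 / real CARD('n)) *\<^sub>R (diag_matrix (U \<omega>) ** B)) (V \<omega>) f) \<and>
               has_expectation M
                 (\<lambda>\<omega>. quad_rule
                    (real n powr (1 / real CARD('n)) *\<^sub>R (diag_matrix (U \<omega>) ** B)) (V \<omega>) f)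
                 (integral\<^sup>L lebesgue f)))"
proof (intro conjI allI impI)
  interpret prob_space M by fact
  note V = assms(2)
  {
    fix S :: "real ^ 'n ^ 'n" and f :: "real ^ 'n \<Rightarrow> real"
    assume "invertible S" and f: "integrable lebesgue f"
    have "random_variable borel V"
      using V by (simp add: uniformly_distributed_def distributed_def)
    \<comment> \<open>For a fixed \<open>S\<close> the role of \<open>U\<close> is taken by the
      constant 0.\<close>
    then have "indep_var borel (\<lambda>_. 0) borel V"
      by (rule indep_var_const) simp
    from quad_rule_unbiased[OF V this, of "\<lambda>_. S" "\<lambda>_. matrix_inv S", OF _ _ f]
    show "AE \<omega> in M. quad_rule_defined S (V \<omega>) f"
      and "has_expectation M (\<lambda>\<omega>. quad_rule S (V \<omega>) f) (integral\<^sup>L lebesgue f)"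
      using \<open>invertible S\<close> by (simp_all add: invertible_matrix_inv)
  next
    fix B :: "real ^ 'n ^ 'n" and n :: nat and U and f :: "real ^ 'n \<Rightarrow> real"
    let ?c = "real n powr (1 / real CARD('n))"
    assume "frolov_matrix B" and "n \<ge> 1"
      and U: "uniformly_distributed M U (cbox (\<chi> i. 1) (\<chi> i. 2 powr (1 / real CARD('n))))"
      and indep: "indep_var borel U borel V" and f: "integrable lebesgue f"
    \<comment> \<open>Almost surely all components of \<open>U\<close> are at least 1, hence
      nonzero, and \<open>n \<ge> 1\<close> makes \<open>?c\<close> nonzero, so the dilated matrix
      has the explicit inverse.\<close>
    have "AE \<omega> in M. (?c *\<^sub>R (diag_matrix (U \<omega>) ** B)) **
        (\<chi> i j. matrix_inv B $ i $ j / (?c * U \<omega> $ j)) = mat 1"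
      using uniformly_distributed_AE[OF U borel_closed[OF closed_cbox]]
    proof eventually_elim
      case (elim \<omega>)
      then have "1 \<le> U \<omega> $ i" for i
        by (simp add: mem_box_cart)
      then have "U \<omega> $ i \<noteq> 0" for i
        by (metis not_one_le_zero)
      then show ?case
        using \<open>frolov_matrix B\<close> \<open>n \<ge> 1\<close>
        by (intro scaled_diag_matrix_right_inverse) (auto simp: frolov_matrix_def)
    qed
    from quad_rule_unbiased[OF V indep, of "\<lambda>u. ?c *\<^sub>R (diag_matrix u ** B)", OF this _ f]
    show "AE \<omega> in M. quad_rule_defined (?c *\<^sub>R (diag_matrix (U \<omega>) ** B)) (V \<omega>) f"
      and "has_expectation M (\<lambda>\<omega>. quad_rule (?c *\<^sub>R (diag_matrix (U \<omega>) ** B)) (V \<omega>) f)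
        (integral\<^sup>L lebesgue f)"
      by simp_all
  }
qed

end
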